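(* Let $H$ be a Hilbert space, let $A$ be the generator of a $C_0$-semigroup $(S(t))_{t\ge 0}$ on $H$ for which there are constants $M,\omega>0$ with $\|S(t)\|\le Me^{-\omega t}$ for all $t\ge 0$, and let $B:H\to H$ be a continuous linear operator. Let $\bar\tau>0$, let $\tau:[0,+\infty)\to(0,+\infty)$ be a continuous function with $0\le\tau(t)\le\bar\tau$ for all $t\ge 0$, and let $k\in L^1_{loc}([-\bar\tau,+\infty);\mathbb{R})$ satisfy, for some $K>0$, $\int_{t-\bar\tau}^t|k(s)|\,ds\le K$ for all $t\ge 0$. Let $f:[-\bar\tau,0]\to H$ be a continuous function and put $U_0:=f(0)$. Then the problem $$U'(t)=AU(t)+k(t)BU(t-\tau(t)),\quad t\in(0,\infty),\qquad U(t)=f(t),\quad t\in[-\bar\tau,0],$$ has a unique (weak) solution, given by Duhamel's formula $$U(t)=S(t)U_0+\int_0^tS(t-s)\,k(s)BU(s-\tau(s))\,ds\qquad\text{for all } t\ge 0.$$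
   Context: A (weak) solution of the problem with initial datum $f$ is a continuous function $U:[-\bar\tau,+\infty)\to H$ with $U(t)=f(t)$ for all $t\in[-\bar\tau,0]$ that satisfies the Duhamel formula displayed in the claim for all $t\ge 0$. Thus the assertion is existence and uniqueness of such a continuous function $U$. *)

theory Defs
  imports "HOL-Analysis.Analysis"
begin

text \<open>
  A Hilbert space is a type of sort \<open>{real_inner, banach}\<close>. A complex Hilbert space is
  covered by restriction of scalars, with the real part of its inner product.

  Operator families on the half-line, and functions on an interval, are total functions on \<open>real\<close>;
  their values outside the interval in question are never used.
\<close>

definition C0_semigroup :: "(real \<Rightarrow> 'a::real_normed_vector \<Rightarrow>\<^sub>L 'a) \<Rightarrow> bool" where
  "C0_semigroup S \<longleftrightarrow>
     S 0 = id_blinfun \<and>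
     (\<forall>s\<ge>0. \<forall>t\<ge>0. S (s + t) = S s o\<^sub>L S t) \<and>
     (\<forall>x. ((\<lambda>t. S t x) \<longlongrightarrow> x) (at_right 0))"

text \<open>
  The generator is in general unbounded: it is the pair of a domain \<open>D\<close> and a map \<open>A\<close> of which only
  the restriction to \<open>D\<close> is meaningful. The domain consists of exactly those points at which the
  difference quotient converges.
\<close>

definition generator_of ::
  "(real \<Rightarrow> 'a::real_normed_vector \<Rightarrow>\<^sub>L 'a) \<Rightarrow> 'a set \<Rightarrow> ('a \<Rightarrow> 'a) \<Rightarrow> bool" where
  "generator_of S D A \<longleftrightarrow>
     D = {x. \<exists>y. ((\<lambda>h. (S h x - x) /\<^sub>R h) \<longlongrightarrow> y) (at_right 0)} \<and>
     (\<forall>x\<in>D. ((\<lambda>h. (S h x - x) /\<^sub>R h) \<longlongrightarrow> A x) (at_right 0))"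

definition L1_loc_on :: "real set \<Rightarrow> (real \<Rightarrow> real) \<Rightarrow> bool" where
  "L1_loc_on X k \<longleftrightarrow> (\<forall>C. compact C \<and> C \<subseteq> X \<longrightarrow> k absolutely_integrable_on C)"

text \<open>
  Weak solutions of \<open>U'(t) = A U(t) + k(t) B U(t - \<tau>(t))\<close> for \<open>t > 0\<close>, with \<open>U = f\<close> on
  \<open>[-\<tau>max, 0]\<close>, where \<open>S\<close> is the semigroup generated by \<open>A\<close>; the equation enters only through
  \<open>S\<close>. The integral is the gauge integral, because the library's Bochner integral requires a
  second-countable range while the Hilbert space need not be separable. For \<open>k\<close> locally integrable
  and \<open>U\<close>, \<open>\<tau>\<close> continuous the integrand is Bochner integrable, and the two integrals agree.
\<close>

definition weak_solution ::
  "(real \<Rightarrow> 'a::{real_inner,banach} \<Rightarrow>\<^sub>L 'a) \<Rightarrow> ('a \<Rightarrow>\<^sub>L 'a) \<Rightarrow> (real \<Rightarrow> real) \<Rightarrow>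
   (real \<Rightarrow> real) \<Rightarrow> real \<Rightarrow> (real \<Rightarrow> 'a) \<Rightarrow> (real \<Rightarrow> 'a) \<Rightarrow> bool" where
  "weak_solution S B k \<tau> \<tau>max f U \<longleftrightarrow>
     continuous_on {-\<tau>max..} U \<and>
     (\<forall>t\<in>{-\<tau>max..0}. U t = f t) \<and>
     (\<forall>t\<ge>0.
        (\<lambda>s. S (t - s) (k s *\<^sub>R B (U (s - \<tau> s)))) integrable_on {0..t} \<and>
        U t = S t (f 0) + integral {0..t} (\<lambda>s. S (t - s) (k s *\<^sub>R B (U (s - \<tau> s)))))"

end

theory Submission
  imports Defs
begin

text \<open>
  Since \<open>\<tau>\<close> is continuous and positive, it is bounded below by some \<open>\<delta> > 0\<close> on each \<open>[0, T]\<close>, so on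
  \<open>[0, t]\<close> the right-hand side of Duhamel's formula depends only on the solution up to time
  \<open>t - \<delta>\<close> (method of steps). Hence two solutions agree on \<open>[-\<tau>max, n \<delta>]\<close> for every \<open>n\<close>, and the
  iterates of the Duhamel map are eventually constant on each \<open>[-\<tau>max, T]\<close>; no contraction or
  Gronwall argument is needed. The analytic content is that the Duhamel map is well defined and
  preserves continuity. As \<open>H\<close> need not be separable, this is done for the gauge integral directly,
  approximating a continuous \<open>h\<close> by step functions \<open>g\<close> so that \<open>k h\<close> is within \<open>e |k|\<close> of the
  integrable \<open>k g\<close>.
\<close>

section \<open>Half-lines, and gauge integration against an integrable weight\<close>

lemma continuous_on_atLeastI:
  fixes f :: "real \<Rightarrow> 'b::topological_space"
  assumes "\<And>T. continuous_on {a..T} f"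
  shows "continuous_on {a..} f"
  unfolding continuous_on_def
proof
  fix x assume "x \<in> {a..}"
  have "at x within {a..x + 1} = at x within {a..}"
    by (rule at_within_nhd[of _ "{..<x + 1}"]) auto
  moreover have "(f \<longlongrightarrow> f x) (at x within {a..x + 1})"
    using assms[of "x + 1"] \<open>x \<in> {a..}\<close> by (simp add: continuous_on_def)
  ultimately show "(f \<longlongrightarrow> f x) (at x within {a..})" by simp
qed

text \<open>On a sufficiently fine tagged division the Riemann sums of \<open>f\<close> and
  \<open>g\<close> differ by at most \<open>e\<close> times the Riemann sum of \<open>w\<close>,
  which stays bounded because it is close to the integral of \<open>w\<close>. So the Cauchy
  criterion passes from \<open>g\<close> to \<open>f\<close>. The weight itself may be unbounded,
  which is what an L1 coefficient requires.\<close>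

lemma integrable_weighted_limit:
  fixes f :: "'n::euclidean_space \<Rightarrow> 'b::banach" and w :: "'n \<Rightarrow> real"
  assumes w: "w integrable_on cbox a b"
    and approx: "\<And>e. e > 0 \<Longrightarrow>
      \<exists>g. g integrable_on cbox a b \<and> (\<forall>x\<in>cbox a b. norm (f x - g x) \<le> e * w x)"
  shows "f integrable_on cbox a b"
  unfolding integrable_Cauchy
proof (intro allI impI)
  fix \<epsilon> :: real assume "\<epsilon> > 0"
  \<comment> \<open>\<open>W\<close> bounds the Riemann sums of \<open>w\<close> on
    \<open>\<gamma>2\<close>-fine divisions, since these lie within 1 of the integral. Below,
    replacing \<open>f\<close> by \<open>g\<close> costs \<open>e * W = \<epsilon> / 4\<close> on
    each of two divisions, and comparing the two sums of \<open>g\<close> costs less than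
    \<open>\<epsilon> / 2\<close>.\<close>
  define W where "W = \<bar>integral (cbox a b) w\<bar> + 1"
  have "W > 0" unfolding W_def by linarith
  define e where "e = \<epsilon> / (4 * W)"
  have "e > 0" using \<open>\<epsilon> > 0\<close> \<open>W > 0\<close> by (simp add: e_def)
  then obtain g where g: "g integrable_on cbox a b"
    and fg: "\<And>x. x \<in> cbox a b \<Longrightarrow> norm (f x - g x) \<le> e * w x"
    using approx by blast
  define R :: "('n \<times> 'n set) set \<Rightarrow> ('n \<Rightarrow> 'b) \<Rightarrow> 'b"
    where "R \<D> u = (\<Sum>(x,K)\<in>\<D>. measure lborel K *\<^sub>R u x)" for \<D> u
  have "\<epsilon> / 2 > 0" using \<open>\<epsilon> > 0\<close> by simp
  with g obtain \<gamma>1 where "gauge \<gamma>1" and \<gamma>1: "\<And>\<D>1 \<D>2. \<lbrakk>\<D>1 tagged_division_of cbox a b; \<gamma>1 fine \<D>1;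
      \<D>2 tagged_division_of cbox a b; \<gamma>1 fine \<D>2\<rbrakk> \<Longrightarrow> norm (R \<D>1 g - R \<D>2 g) < \<epsilon> / 2"
    unfolding integrable_Cauchy R_def by meson
  obtain \<gamma>2 where "gauge \<gamma>2" and \<gamma>2: "\<And>\<D>. \<lbrakk>\<D> tagged_division_of cbox a b; \<gamma>2 fine \<D>\<rbrakk> \<Longrightarrow>
      norm ((\<Sum>(x,K)\<in>\<D>. measure lborel K *\<^sub>R w x) - integral (cbox a b) w) < 1"
    using integrable_integral[OF w] unfolding has_integral by (meson zero_less_one)
  have close: "norm (R \<D> f - R \<D> g) \<le> \<epsilon> / 4"
    if \<D>: "\<D> tagged_division_of cbox a b" and fine: "\<gamma>2 fine \<D>" for \<D>
  proof -
    have "norm (R \<D> f - R \<D> g) = norm (\<Sum>(x,K)\<in>\<D>. measure lborel K *\<^sub>R (f x - g x))"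
      by (simp add: R_def sum_subtractf[symmetric] case_prod_unfold scaleR_diff_right)
    also have "\<dots> \<le> (\<Sum>(x,K)\<in>\<D>. e * (measure lborel K *\<^sub>R w x))"
    proof (rule sum_norm_le, clarsimp)
      fix x K assume "(x, K) \<in> \<D>"
      then have "x \<in> cbox a b" using tagged_division_ofD(2,3)[OF \<D>] by blast
      then have "measure lborel K * norm (f x - g x) \<le> measure lborel K * (e * w x)"
        by (intro mult_left_mono fg) auto
      then show "measure lborel K * norm (f x - g x) \<le> e * (measure lborel K * w x)"
        by (simp add: mult_ac)
    qed
    also have "\<dots> = e * (\<Sum>(x,K)\<in>\<D>. measure lborel K *\<^sub>R w x)"
      by (simp add: sum_distrib_left case_prod_unfold)
    also have "\<dots> \<le> e * W"
      using \<gamma>2[OF \<D> fine] \<open>e > 0\<close> unfolding W_def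
      by (intro mult_left_mono) (auto simp: abs_if split: if_splits)
    also have "\<dots> = \<epsilon> / 4" using \<open>W > 0\<close> by (simp add: e_def)
    finally show ?thesis .
  qed
  show "\<exists>\<gamma>. gauge \<gamma> \<and> (\<forall>\<D>1 \<D>2. \<D>1 tagged_division_of cbox a b \<and> \<gamma> fine \<D>1 \<and>
      \<D>2 tagged_division_of cbox a b \<and> \<gamma> fine \<D>2 \<longrightarrow>
      norm ((\<Sum>(x,K)\<in>\<D>1. measure lborel K *\<^sub>R f x) - (\<Sum>(x,K)\<in>\<D>2. measure lborel K *\<^sub>R f x)) < \<epsilon>)"
    unfolding R_def[symmetric]
  proof (intro exI[of _ "\<lambda>x. \<gamma>1 x \<inter> \<gamma>2 x"] conjI allI impI, goal_cases)
    case 1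
    show ?case using \<open>gauge \<gamma>1\<close> \<open>gauge \<gamma>2\<close> by (rule gauge_Int)
  next
    case (2 \<D>1 \<D>2)
    then have "norm (R \<D>1 f - R \<D>1 g) \<le> \<epsilon> / 4" "norm (R \<D>2 f - R \<D>2 g) \<le> \<epsilon> / 4"
      "norm (R \<D>1 g - R \<D>2 g) < \<epsilon> / 2"
      by (simp_all only: fine_Int close \<gamma>1)
    moreover have "norm (R \<D>1 f - R \<D>2 f) =
        norm ((R \<D>1 f - R \<D>1 g) - (R \<D>2 f - R \<D>2 g) + (R \<D>1 g - R \<D>2 g))"
      by simp
    ultimately show ?case
      using norm_triangle_ineq[of "(R \<D>1 f - R \<D>1 g) - (R \<D>2 f - R \<D>2 g)" "R \<D>1 g - R \<D>2 g"]
        norm_triangle_ineq4[of "R \<D>1 f - R \<D>1 g" "R \<D>2 f - R \<D>2 g"]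
      by linarith
  qed
qed

text \<open>Near a point \<open>x\<close>, freezing \<open>h\<close> at \<open>h x\<close> leaves a
  scalar integrable function times a fixed vector, with error at most
  \<open>e * \<bar>k s\<bar>\<close>. Bisection patches these local approximants together, and the
  weighted limit with weight \<open>\<bar>k\<bar>\<close> finishes.\<close>

lemma integrable_scaleR_continuous:
  fixes k :: "real \<Rightarrow> real" and h :: "real \<Rightarrow> 'b::banach"
  assumes k: "k absolutely_integrable_on {a..b}" and h: "continuous_on {a..b} h"
  shows "(\<lambda>s. k s *\<^sub>R h s) integrable_on {a..b}"
proof (cases "a \<le> b")
  case True
  have kint: "k integrable_on {a..b}" and absk: "(\<lambda>s. \<bar>k s\<bar>) integrable_on {a..b}"
    using k by (auto simp: absolutely_integrable_on_def)
  have "\<exists>g. g integrable_on {a..b} \<and> (\<forall>s\<in>{a..b}. norm (k s *\<^sub>R h s - g s) \<le> e * \<bar>k s\<bar>)"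
    if "e > 0" for e
  proof -
    \<comment> \<open>The two guards are there because the local case of \<open>Bolzano\<close> also
      ranges over intervals around \<open>x\<close> that stick out of \<open>{a..b}\<close>.\<close>
    define P where "P u v \<longleftrightarrow> (a \<le> u \<longrightarrow> v \<le> b \<longrightarrow>
      (\<exists>g. g integrable_on {u..v} \<and> (\<forall>s\<in>{u..v}. norm (k s *\<^sub>R h s - g s) \<le> e * \<bar>k s\<bar>)))" for u v
    have "P a b"
      using True
    proof (induction rule: Bolzano)
      case (trans u v w)
      show ?case unfolding P_def
      proof (intro impI)
        assume bnds: "a \<le> u" "w \<le> b"
        have "v \<le> b" "a \<le> v" using trans(3,4) bnds by simp_all
        obtain g1 where g1: "g1 integrable_on {u..v}"
            "\<And>s. s\<in>{u..v} \<Longrightarrow> norm (k s *\<^sub>R h s - g1 s) \<le> e * \<bar>k s\<bar>"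
          using trans(1) bnds(1) \<open>v \<le> b\<close> unfolding P_def by blast
        obtain g2 where g2: "g2 integrable_on {v..w}"
            "\<And>s. s\<in>{v..w} \<Longrightarrow> norm (k s *\<^sub>R h s - g2 s) \<le> e * \<bar>k s\<bar>"
          using trans(2) bnds(2) \<open>a \<le> v\<close> unfolding P_def by blast
        define g where "g s = (if s \<le> v then g1 s else g2 s)" for s
        have "g integrable_on {u..v}"
          using g1(1) by (rule integrable_eq) (simp add: g_def)
        moreover have "g integrable_on {v..w}"
          \<comment> \<open>At the common endpoint \<open>v\<close> the glued function takes the
            value of \<open>g1\<close>, so it differs from \<open>g2\<close> on
            \<open>{v..w}\<close> at most there.\<close>
          using g2(1) by (rule integrable_spike_finite[of "{v}", rotated 2]) (auto simp: g_def)
        ultimately have "g integrable_on {u..w}"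
          by (rule Henstock_Kurzweil_Integration.integrable_combine[OF trans(3,4)])
        then show "\<exists>g. g integrable_on {u..w} \<and>
            (\<forall>s\<in>{u..w}. norm (k s *\<^sub>R h s - g s) \<le> e * \<bar>k s\<bar>)"
          using g1(2) g2(2) by (intro exI[of _ g]) (auto simp: g_def)
      qed
    next
      case (local x)
      then obtain d where "d > 0"
        and d: "\<And>s. s \<in> {a..b} \<Longrightarrow> dist s x < d \<Longrightarrow> dist (h s) (h x) < e"
        using h \<open>e > 0\<close> unfolding continuous_on_iff by (meson atLeastAtMost_iff)
      have "P u v" if uv: "u \<le> x" "x \<le> v" "v - u < d" for u v
        unfolding P_def
      proof (intro impI exI conjI ballI)
        assume "a \<le> u" "v \<le> b"
        then show "(\<lambda>s. k s *\<^sub>R h x) integrable_on {u..v}"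
          by (intro integrable_on_scaleR_left integrable_on_subinterval[OF kint]) auto
        fix s assume "s \<in> {u..v}"
        then have "dist (h s) (h x) < e"
          using uv \<open>a \<le> u\<close> \<open>v \<le> b\<close> by (intro d) (auto simp: dist_real_def)
        then have "\<bar>k s\<bar> * norm (h s - h x) \<le> \<bar>k s\<bar> * e"
          by (intro mult_left_mono) (auto simp: dist_norm)
        then show "norm (k s *\<^sub>R h s - k s *\<^sub>R h x) \<le> e * \<bar>k s\<bar>"
          by (metis mult.commute norm_scaleR scaleR_diff_right)
      qed
      then show ?case using \<open>d > 0\<close> by blast
    qed
    then show ?thesis by (simp add: P_def)
  qed
  then show ?thesis
    using integrable_weighted_limit[of "\<lambda>s. \<bar>k s\<bar>" a b "\<lambda>s. k s *\<^sub>R h s"] absk by simp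
qed auto

text \<open>By compactness \<open>H\<close> is uniformly continuous, so a small change of
  \<open>t\<close> moves \<open>H (t, s)\<close> by a small amount uniformly in \<open>s\<close>;
  the integral then moves by at most that amount times the L1 norm of \<open>k\<close>.\<close>

lemma continuous_on_integral_param:
  fixes k :: "real \<Rightarrow> real" and H :: "'t::metric_space \<times> real \<Rightarrow> 'b::banach"
  assumes k: "k absolutely_integrable_on {a..b}"
    and X: "compact X" and H: "continuous_on (X \<times> {a..b}) H"
  shows "continuous_on X (\<lambda>t. integral {a..b} (\<lambda>s. k s *\<^sub>R H (t, s)))"
  unfolding continuous_on_iff
proof (intro ballI allI impI)
  fix t and \<epsilon> :: real assume "t \<in> X" "\<epsilon> > 0"
  have absk: "(\<lambda>s. \<bar>k s\<bar>) integrable_on {a..b}"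
    using k by (auto simp: absolutely_integrable_on_def)
  \<comment> \<open>The added 1 makes \<open>W\<close> positive even if \<open>k\<close> vanishes,
    and yields the strict bound \<open>(\<epsilon> / W) * (W - 1) < \<epsilon>\<close> at the
    end.\<close>
  define W where "W = integral {a..b} (\<lambda>s. \<bar>k s\<bar>) + 1"
  have "W > 0" unfolding W_def
    by (intro add_nonneg_pos integral_nonneg absk) auto
  have uc: "uniformly_continuous_on (X \<times> {a..b}) H"
    using H X by (intro compact_uniformly_continuous compact_Times) auto
  have "\<epsilon> / W > 0" using \<open>\<epsilon> > 0\<close> \<open>W > 0\<close> by simp
  from uc[unfolded uniformly_continuous_on_def, rule_format, OF this]
  obtain d where "d > 0" and d: "\<And>p q. p \<in> X \<times> {a..b} \<Longrightarrow> q \<in> X \<times> {a..b} \<Longrightarrow>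
      dist q p < d \<Longrightarrow> dist (H q) (H p) < \<epsilon> / W"
    by blast
  have int: "(\<lambda>s. k s *\<^sub>R H (r, s)) integrable_on {a..b}" if "r \<in> X" for r
    using that by (intro integrable_scaleR_continuous k continuous_on_compose2[OF H])
      (auto intro!: continuous_intros)
  have "dist (integral {a..b} (\<lambda>s. k s *\<^sub>R H (r, s))) (integral {a..b} (\<lambda>s. k s *\<^sub>R H (t, s))) < \<epsilon>"
    if r: "r \<in> X" "dist r t < d" for r
  proof -
    have "dist (integral {a..b} (\<lambda>s. k s *\<^sub>R H (r, s))) (integral {a..b} (\<lambda>s. k s *\<^sub>R H (t, s)))
        = norm (integral {a..b} (\<lambda>s. k s *\<^sub>R H (r, s) - k s *\<^sub>R H (t, s)))"
      using r \<open>t \<in> X\<close> by (simp add: dist_norm integral_diff int)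
    also have "\<dots> \<le> integral {a..b} (\<lambda>s. (\<epsilon> / W) * \<bar>k s\<bar>)"
    proof (rule integral_norm_bound_integral)
      fix s assume "s \<in> {a..b}"
      then have "dist (H (r, s)) (H (t, s)) < \<epsilon> / W"
        using r \<open>t \<in> X\<close> by (intro d) (auto simp: dist_Pair_Pair)
      then have "\<bar>k s\<bar> * norm (H (r, s) - H (t, s)) \<le> \<bar>k s\<bar> * (\<epsilon> / W)"
        by (intro mult_left_mono) (auto simp: dist_norm)
      then show "norm (k s *\<^sub>R H (r, s) - k s *\<^sub>R H (t, s)) \<le> (\<epsilon> / W) * \<bar>k s\<bar>"
        by (metis mult.commute norm_scaleR scaleR_diff_right)
    next
      show "(\<lambda>s. (\<epsilon> / W) * \<bar>k s\<bar>) integrable_on {a..b}"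
        using absk by (rule integrable_on_mult_right)
    qed (use r \<open>t \<in> X\<close> in \<open>auto intro!: integrable_diff int\<close>)
    also have "\<dots> = (\<epsilon> / W) * (W - 1)" by (simp add: W_def)
    also have "\<dots> < \<epsilon>" using \<open>W > 0\<close> \<open>\<epsilon> > 0\<close> by (simp add: field_simps)
    finally show ?thesis .
  qed
  then show "\<exists>d>0. \<forall>r\<in>X. dist r t < d \<longrightarrow>
      dist (integral {a..b} (\<lambda>s. k s *\<^sub>R H (r, s))) (integral {a..b} (\<lambda>s. k s *\<^sub>R H (t, s))) < \<epsilon>"
    using \<open>d > 0\<close> by blast
qed


section \<open>Joint continuity of a bounded semigroup\<close>

text \<open>For \<open>u < v\<close> the increment of the orbit is
  \<open>S u (S (v - u) x - x)\<close>, so right continuity at 0 and the uniform bound give one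
  modulus for all pairs of times. In particular orbits are continuous from the left as well.\<close>

lemma C0_semigroup_orbit_modulus:
  fixes S :: "real \<Rightarrow> 'a::real_normed_vector \<Rightarrow>\<^sub>L 'a"
  assumes S: "C0_semigroup S" and M: "\<And>t. t \<ge> 0 \<Longrightarrow> norm (S t) \<le> M" and "e > 0"
  obtains d where "d > 0"
    "\<And>u v. u \<ge> 0 \<Longrightarrow> v \<ge> 0 \<Longrightarrow> \<bar>u - v\<bar> < d \<Longrightarrow> norm (S u x - S v x) < e"
proof -
  have "M \<ge> 0" using M[of 0] norm_ge_zero[of "S 0"] by linarith
  have "((\<lambda>t. S t x) \<longlongrightarrow> x) (at_right 0)"
    using S by (simp add: C0_semigroup_def)
  \<comment> \<open>Dividing by \<open>M + 1\<close> covers \<open>M = 0\<close> and makes the final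
    estimate strict.\<close>
  moreover have "e / (M + 1) > 0" using \<open>e > 0\<close> \<open>M \<ge> 0\<close> by simp
  ultimately have "\<forall>\<^sub>F t in at_right 0. dist (S t x) x < e / (M + 1)"
    by (rule tendstoD)
  then obtain d where "d > 0" and d: "\<And>t. 0 < t \<Longrightarrow> t < d \<Longrightarrow> dist (S t x) x < e / (M + 1)"
    by (auto simp: eventually_at_right_field)
  have *: "norm (S v x - S u x) < e" if "0 \<le> u" "u < v" "v - u < d" for u v
  proof -
    have "S v = S (u + (v - u))" by simp
    also have "\<dots> = S u o\<^sub>L S (v - u)"
      using S that unfolding C0_semigroup_def by (metis diff_ge_0_iff_ge less_imp_le)
    finally have "S v x - S u x = S u (S (v - u) x - x)"
      by (simp add: blinfun.diff_right)
    then have "norm (S v x - S u x) \<le> norm (S u) * norm (S (v - u) x - x)"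
      by (simp add: norm_blinfun)
    also have "\<dots> \<le> M * (e / (M + 1))"
      using d[of "v - u"] that \<open>M \<ge> 0\<close> by (intro mult_mono M) (auto simp: dist_norm)
    also have "\<dots> < e" using \<open>e > 0\<close> \<open>M \<ge> 0\<close> by (simp add: field_simps)
    finally show ?thesis .
  qed
  have "norm (S u x - S v x) < e" if "u \<ge> 0" "v \<ge> 0" "\<bar>u - v\<bar> < d" for u v
    using *[of u v] *[of v u] that \<open>e > 0\<close>
    by (cases u v rule: linorder_cases) (auto simp: norm_minus_commute)
  with \<open>d > 0\<close> show thesis by (rule that)
qed

text \<open>Split \<open>S v y - S u x\<close> into \<open>S v (y - x)\<close>, controlled by the
  uniform bound, and \<open>S v x - S u x\<close>, controlled by the orbit modulus.\<close>

lemma C0_semigroup_jointly_continuous: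
  fixes S :: "real \<Rightarrow> 'a::real_normed_vector \<Rightarrow>\<^sub>L 'a"
  assumes S: "C0_semigroup S" and M: "\<And>t. t \<ge> 0 \<Longrightarrow> norm (S t) \<le> M"
  shows "continuous_on ({0..} \<times> UNIV) (\<lambda>(u, x). S u x)"
  unfolding continuous_on_def
proof
  fix q :: "real \<times> 'a" assume "q \<in> {0..} \<times> UNIV"
  then obtain u x where q: "q = (u, x)" and "u \<in> {0..}" by blast
  let ?F = "at (u, x) within {0..} \<times> UNIV"
  have lim: "((\<lambda>p. M * norm (snd p - x) + norm (S (fst p) x - S u x)) \<longlongrightarrow> 0) ?F"
  proof (rule tendsto_add_zero)
    have "((\<lambda>p. M * norm (snd p - x)) \<longlongrightarrow> M * norm (snd (u, x) - x)) ?F"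
      by (intro tendsto_intros)
    then show "((\<lambda>p. M * norm (snd p - x)) \<longlongrightarrow> 0) ?F" by simp
    show "((\<lambda>p. norm (S (fst p) x - S u x)) \<longlongrightarrow> 0) ?F"
    proof (rule tendstoI)
      fix e :: real assume "e > 0"
      obtain d where "d > 0"
        and d: "\<And>u v. u \<ge> 0 \<Longrightarrow> v \<ge> 0 \<Longrightarrow> \<bar>u - v\<bar> < d \<Longrightarrow> norm (S u x - S v x) < e"
        using C0_semigroup_orbit_modulus[OF S M \<open>e > 0\<close>] by blast
      have "(fst \<longlongrightarrow> fst (u, x)) ?F" by (intro tendsto_intros)
      then have "\<forall>\<^sub>F p in ?F. dist (fst p) u < d" using \<open>d > 0\<close> by (simp add: tendstoD)
      moreover have "\<forall>\<^sub>F p in ?F. p \<in> {0..} \<times> UNIV" by (simp add: eventually_at_filter)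
      ultimately show "\<forall>\<^sub>F p in ?F. dist (norm (S (fst p) x - S u x)) 0 < e"
        by eventually_elim (use \<open>u \<in> {0..}\<close> in \<open>auto intro!: d simp: dist_real_def\<close>)
    qed
  qed
  have "\<forall>\<^sub>F p in ?F. norm ((case p of (v, y) \<Rightarrow> S v y) - S u x)
      \<le> M * norm (snd p - x) + norm (S (fst p) x - S u x)"
  proof -
    have "norm (S v y - S u x) \<le> M * norm (y - x) + norm (S v x - S u x)" if "v \<ge> 0" for v y
    proof -
      have "S v y - S u x = S v (y - x) + (S v x - S u x)" by (simp add: blinfun.diff_right)
      then have "norm (S v y - S u x) \<le> norm (S v (y - x)) + norm (S v x - S u x)"
        by (metis norm_triangle_ineq)
      also have "norm (S v (y - x)) \<le> M * norm (y - x)"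
        using norm_blinfun[of "S v" "y - x"] M[OF that]
        by (meson mult_right_mono norm_ge_zero order_trans)
      finally show ?thesis by simp
    qed
    then show ?thesis by (auto simp: eventually_at_filter intro!: always_eventually)
  qed
  then have "((\<lambda>p. (case p of (v, y) \<Rightarrow> S v y) - S u x) \<longlongrightarrow> 0) ?F"
    using lim by (rule Lim_null_comparison)
  then show "((\<lambda>(v, y). S v y) \<longlongrightarrow> (case q of (v, y) \<Rightarrow> S v y)) (at q within {0..} \<times> UNIV)"
    by (simp add: q LIM_zero_cancel)
qed

lemma continuous_on_C0_semigroup:
  assumes S: "C0_semigroup S" and M: "\<And>t. t \<ge> 0 \<Longrightarrow> norm (S t) \<le> M"
    and u: "continuous_on X u" "\<And>x. x \<in> X \<Longrightarrow> u x \<ge> 0" and g: "continuous_on X g"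
  shows "continuous_on X (\<lambda>x. S (u x) (g x))"
  using continuous_on_compose2[OF C0_semigroup_jointly_continuous[OF S M] continuous_on_Pair[OF u(1) g]] u(2)
  by auto

section \<open>The Duhamel integral\<close>

lemma duhamel_integrable:
  fixes S :: "real \<Rightarrow> 'a::banach \<Rightarrow>\<^sub>L 'a"
  assumes S: "C0_semigroup S" and M: "\<And>t. t \<ge> 0 \<Longrightarrow> norm (S t) \<le> M"
    and k: "k absolutely_integrable_on {0..t}" and g: "continuous_on {0..t} g"
  shows "(\<lambda>s. S (t - s) (k s *\<^sub>R g s)) integrable_on {0..t}"
proof -
  have "continuous_on {0..t} (\<lambda>s. S (t - s) (g s))"
    by (rule continuous_on_C0_semigroup[OF S M]) (auto intro!: continuous_intros g)
  from integrable_scaleR_continuous[OF k this] show ?thesis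
    by (simp add: blinfun.scaleR_right)
qed

text \<open>The variable \<open>t\<close> is both an integration limit and a parameter of the
  integrand. The two roles are separated into a parameter integral over the fixed interval
  \<open>{0..T}\<close> and an indefinite integral of \<open>k s *\<^sub>R g s\<close>, each
  continuous in \<open>t\<close>.\<close>

lemma duhamel_continuous:
  fixes S :: "real \<Rightarrow> 'a::banach \<Rightarrow>\<^sub>L 'a"
  assumes S: "C0_semigroup S" and M: "\<And>t. t \<ge> 0 \<Longrightarrow> norm (S t) \<le> M"
    and k: "k absolutely_integrable_on {0..T}" and g: "continuous_on {0..T} g"
  shows "continuous_on {0..T} (\<lambda>t. integral {0..t} (\<lambda>s. S (t - s) (k s *\<^sub>R g s)))"
proof -
  have id: "S 0 = id_blinfun" using S by (simp add: C0_semigroup_def)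
  define H where "H p = S (max (fst p - snd p) 0) (g (snd p))" for p
  have H: "continuous_on ({0..T} \<times> {0..T}) H"
    unfolding H_def
    by (rule continuous_on_C0_semigroup[OF S M])
      (auto intro!: continuous_intros continuous_on_compose2[OF g])
  have kg: "(\<lambda>s. k s *\<^sub>R g s) integrable_on {0..T}"
    using k g by (rule integrable_scaleR_continuous)
  \<comment> \<open>Freezing the semigroup at time 0 for \<open>s > t\<close> makes the integrand jointly continuous.\<close>
  have eq: "integral {0..T} (\<lambda>s. k s *\<^sub>R H (t, s)) - integral {0..T} (\<lambda>s. k s *\<^sub>R g s)
      + integral {0..t} (\<lambda>s. k s *\<^sub>R g s) = integral {0..t} (\<lambda>s. S (t - s) (k s *\<^sub>R g s))"
    if t: "t \<in> {0..T}" for t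
  proof -
    have "continuous_on {0..T} (\<lambda>s. H (t, s))"
      by (rule continuous_on_compose2[OF H]) (use t in \<open>auto intro!: continuous_intros\<close>)
    then have kH: "(\<lambda>s. k s *\<^sub>R H (t, s)) integrable_on {0..T}"
      by (rule integrable_scaleR_continuous[OF k])
    have "integral {0..T} (\<lambda>s. k s *\<^sub>R H (t, s)) =
        integral {0..t} (\<lambda>s. k s *\<^sub>R H (t, s)) + integral {t..T} (\<lambda>s. k s *\<^sub>R H (t, s))"
      using Henstock_Kurzweil_Integration.integral_combine[OF _ _ kH, of t] t by simp
    moreover have "integral {0..T} (\<lambda>s. k s *\<^sub>R g s) =
        integral {0..t} (\<lambda>s. k s *\<^sub>R g s) + integral {t..T} (\<lambda>s. k s *\<^sub>R g s)"
      using Henstock_Kurzweil_Integration.integral_combine[OF _ _ kg, of t] t by simp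
    moreover have "integral {t..T} (\<lambda>s. k s *\<^sub>R H (t, s)) = integral {t..T} (\<lambda>s. k s *\<^sub>R g s)"
      by (rule Henstock_Kurzweil_Integration.integral_cong) (simp add: H_def id)
    moreover have "integral {0..t} (\<lambda>s. k s *\<^sub>R H (t, s)) =
        integral {0..t} (\<lambda>s. S (t - s) (k s *\<^sub>R g s))"
      by (rule Henstock_Kurzweil_Integration.integral_cong)
        (simp add: H_def blinfun.scaleR_right)
    ultimately show ?thesis by simp
  qed
  have "continuous_on {0..T} (\<lambda>t. integral {0..T} (\<lambda>s. k s *\<^sub>R H (t, s))
      - integral {0..T} (\<lambda>s. k s *\<^sub>R g s) + integral {0..t} (\<lambda>s. k s *\<^sub>R g s))"
    by (intro continuous_intros continuous_on_integral_param[OF k _ H]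
        indefinite_integral_continuous_1 kg) auto
  then show ?thesis
    by (rule continuous_on_eq) (rule eq)
qed

section \<open>The Duhamel map and the method of steps\<close>

text \<open>The case split builds the initial condition into the fixed-point equation. As
  \<open>S 0\<close> is the identity, both branches would give \<open>f 0\<close> at
  \<open>t = 0\<close>.\<close>

definition duhamel_map ::
  "(real \<Rightarrow> 'a::banach \<Rightarrow>\<^sub>L 'a) \<Rightarrow> ('a \<Rightarrow>\<^sub>L 'a) \<Rightarrow> (real \<Rightarrow> real) \<Rightarrow>
   (real \<Rightarrow> real) \<Rightarrow> (real \<Rightarrow> 'a) \<Rightarrow> (real \<Rightarrow> 'a) \<Rightarrow> real \<Rightarrow> 'a" where
  "duhamel_map S B k \<tau> f U t =
     (if t \<le> 0 then f t
      else S t (f 0) + integral {0..t} (\<lambda>s. S (t - s) (k s *\<^sub>R B (U (s - \<tau> s)))))"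

lemma duhamel_map_nonpos [simp]: "t \<le> 0 \<Longrightarrow> duhamel_map S B k \<tau> f U t = f t"
  by (simp add: duhamel_map_def)

lemma duhamel_map_nonneg:
  assumes "C0_semigroup S" "t \<ge> 0"
  shows "duhamel_map S B k \<tau> f U t =
    S t (f 0) + integral {0..t} (\<lambda>s. S (t - s) (k s *\<^sub>R B (U (s - \<tau> s))))"
proof (cases "t = 0")
  case True
  then show ?thesis using assms(1) by (simp add: C0_semigroup_def)
qed (use assms in \<open>simp add: duhamel_map_def\<close>)

lemma delayed_continuous:
  fixes U :: "real \<Rightarrow> 'a::real_normed_vector" and B :: "'a \<Rightarrow>\<^sub>L 'b::real_normed_vector"
  assumes "continuous_on {-r..} U" "continuous_on {0..} \<tau>" "\<And>t. t \<ge> 0 \<Longrightarrow> \<tau> t \<le> r"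
  shows "continuous_on {0..} (\<lambda>s. B (U (s - \<tau> s)))"
proof -
  have "s - \<tau> s \<ge> -r" if "s \<ge> 0" for s using assms(3)[OF that] that by simp
  then show ?thesis
    by (intro continuous_intros continuous_on_compose2[OF assms(1)] assms(2)) auto
qed

lemma duhamel_map_continuous:
  assumes S: "C0_semigroup S" and M: "\<And>t. t \<ge> 0 \<Longrightarrow> norm (S t) \<le> M"
    and k: "\<And>T. k absolutely_integrable_on {0..T}"
    and \<tau>: "continuous_on {0..} \<tau>" "\<And>t. t \<ge> 0 \<Longrightarrow> \<tau> t \<le> r"
    and f: "continuous_on {-r..0} f" and U: "continuous_on {-r..} U" and "r \<ge> 0"
  shows "continuous_on {-r..} (duhamel_map S B k \<tau> f U)"
proof -
  let ?F = "\<lambda>t. S t (f 0) + integral {0..t} (\<lambda>s. S (t - s) (k s *\<^sub>R B (U (s - \<tau> s))))"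
  have "continuous_on {0..T} ?F" for T
    by (intro continuous_intros duhamel_continuous[OF S M k] continuous_on_C0_semigroup[OF S M]
        continuous_on_subset[OF delayed_continuous[OF U \<tau>]]) auto
  then have "continuous_on {0..} ?F"
    by (rule continuous_on_atLeastI)
  then have "continuous_on {0..} (duhamel_map S B k \<tau> f U)"
    by (rule continuous_on_eq) (simp add: duhamel_map_nonneg[OF S])
  moreover have "continuous_on {-r..0} (duhamel_map S B k \<tau> f U)"
    using f by (rule continuous_on_eq) simp
  ultimately have "continuous_on ({-r..0} \<union> {0..}) (duhamel_map S B k \<tau> f U)"
    by (intro continuous_on_closed_Un) auto
  moreover have "{-r..0} \<union> {0..} = {-r..}" using \<open>r \<ge> 0\<close> by auto
  ultimately show ?thesis by simp
qed

text \<open>For \<open>s\<close> in \<open>{0..t}\<close> the delayed time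
  \<open>s - \<tau> s\<close> lies between \<open>-r\<close> and \<open>t - \<delta>\<close>, hence
  in \<open>{-r..a}\<close>. Both \<open>\<delta> > 0\<close> (a gain of one step) and
  \<open>\<delta> = 0\<close> (plain causality) are used.\<close>

lemma duhamel_map_causal:
  assumes \<tau>: "\<And>s. s \<in> {0..t} \<Longrightarrow> \<delta> \<le> \<tau> s \<and> \<tau> s \<le> r" and "t \<le> a + \<delta>"
    and eq: "\<And>s. s \<in> {-r..a} \<Longrightarrow> U s = V s"
  shows "duhamel_map S B k \<tau> f U t = duhamel_map S B k \<tau> f V t"
proof -
  have "U (s - \<tau> s) = V (s - \<tau> s)" if "s \<in> {0..t}" for s
    using \<tau>[OF that] that \<open>t \<le> a + \<delta>\<close> by (intro eq) auto
  then have "integral {0..t} (\<lambda>s. S (t - s) (k s *\<^sub>R B (U (s - \<tau> s)))) =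
      integral {0..t} (\<lambda>s. S (t - s) (k s *\<^sub>R B (V (s - \<tau> s))))"
    by (intro Henstock_Kurzweil_Integration.integral_cong) simp
  then show ?thesis by (simp add: duhamel_map_def)
qed

text \<open>Each application of the Duhamel map lengthens the interval of agreement by
  \<open>\<delta>\<close>, the minimum of \<open>\<tau>\<close> on \<open>{0..T}\<close>, so
  finitely many reach \<open>T\<close>. Allowing two arbitrary orbits covers uniqueness (constant
  sequences) and stabilization of the iterates (a sequence and its shift).\<close>

lemma method_of_steps:
  assumes \<tau>: "continuous_on {0..} \<tau>" "\<And>t. t \<ge> 0 \<Longrightarrow> 0 < \<tau> t \<and> \<tau> t \<le> r"
    and init: "\<And>t. t \<in> {-r..0} \<Longrightarrow> U 0 t = V 0 t"
    and U: "\<And>n t. t \<in> {-r..T} \<Longrightarrow> U (Suc n) t = duhamel_map S B k \<tau> f (U n) t"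
    and V: "\<And>n t. t \<in> {-r..T} \<Longrightarrow> V (Suc n) t = duhamel_map S B k \<tau> f (V n) t"
  shows "\<exists>N. \<forall>n\<ge>N. \<forall>t\<in>{-r..T}. U n t = V n t"
proof -
  obtain \<delta> where "\<delta> > 0" and \<delta>: "\<And>s. s \<in> {0..T} \<Longrightarrow> \<delta> \<le> \<tau> s"
  proof (cases "T \<ge> 0")
    case True
    have "continuous_on {0..T} \<tau>" by (rule continuous_on_subset[OF \<tau>(1)]) auto
    then obtain s0 where "s0 \<in> {0..T}" "\<And>s. s \<in> {0..T} \<Longrightarrow> \<tau> s0 \<le> \<tau> s"
      using continuous_attains_inf[of "{0..T}" \<tau>] True by auto
    then show thesis using \<tau>(2)[of s0] by (intro that[of "\<tau> s0"]) auto
  \<comment> \<open>For \<open>T < 0\<close> the interval \<open>{0..T}\<close> is empty and any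
    positive number serves.\<close>
  qed (auto intro: that[of 1])
  \<comment> \<open>The cap at \<open>T\<close> is needed since the recursions and the lower bound
    on \<open>\<tau>\<close> are available only up to \<open>T\<close>.\<close>
  have agree: "U n t = V n t" if "t \<in> {-r..min T (real n * \<delta>)}" for n t
    using that
  proof (induction n arbitrary: t)
    case 0
    then show ?case using init by simp
  next
    case (Suc n)
    then have "t \<le> real n * \<delta> + \<delta>" and t: "t \<in> {-r..T}"
      by (simp_all add: algebra_simps)
    then have "t \<le> min T (real n * \<delta>) + \<delta>"
      using \<open>\<delta> > 0\<close> by (simp add: min_def)
    have "duhamel_map S B k \<tau> f (U n) t = duhamel_map S B k \<tau> f (V n) t"
    proof (rule duhamel_map_causal)
      show "\<delta> \<le> \<tau> s \<and> \<tau> s \<le> r" if "s \<in> {0..t}" for s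
        using t that \<tau>(2)[of s] \<delta>[of s] by simp
    qed fact+
    then show ?case using U[OF t] V[OF t] by simp
  qed
  show ?thesis
  proof (intro exI allI impI ballI)
    fix n t assume "nat \<lceil>T / \<delta>\<rceil> \<le> n" "t \<in> {-r..T}"
    then have "T / \<delta> \<le> real n" by linarith
    then have "T \<le> real n * \<delta>" using \<open>\<delta> > 0\<close> by (simp add: pos_divide_le_eq)
    then show "U n t = V n t" using \<open>t \<in> {-r..T}\<close> by (intro agree) auto
  qed
qed

section \<open>Weak solutions as fixed points of the Duhamel map\<close>

text \<open>For continuous \<open>U\<close> the integrability clause of \<open>weak_solution\<close>
  holds automatically, and the initial condition and Duhamel's formula are the two branches of the
  map, overlapping consistently at 0.\<close>

lemma weak_solution_iff_duhamel_map:
  assumes S: "C0_semigroup S" and M: "\<And>t. t \<ge> 0 \<Longrightarrow> norm (S t) \<le> M"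
    and k: "\<And>T. k absolutely_integrable_on {0..T}"
    and \<tau>: "continuous_on {0..} \<tau>" "\<And>t. t \<ge> 0 \<Longrightarrow> \<tau> t \<le> r" and "r \<ge> 0"
  shows "weak_solution S B k \<tau> r f U \<longleftrightarrow>
    continuous_on {-r..} U \<and> (\<forall>t\<ge>-r. U t = duhamel_map S B k \<tau> f U t)"
proof (cases "continuous_on {-r..} U")
  case True
  have int: "(\<lambda>s. S (t - s) (k s *\<^sub>R B (U (s - \<tau> s)))) integrable_on {0..t}" for t
    by (intro duhamel_integrable[OF S M k] continuous_on_subset[OF delayed_continuous[OF True \<tau>]])
      auto
  have "(\<forall>t\<ge>-r. U t = duhamel_map S B k \<tau> f U t) \<longleftrightarrow>
      (\<forall>t\<in>{-r..0}. U t = duhamel_map S B k \<tau> f U t) \<and>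
      (\<forall>t\<ge>0. U t = duhamel_map S B k \<tau> f U t)"
    using \<open>r \<ge> 0\<close> by (meson atLeastAtMost_iff linear neg_le_0_iff_le order_trans)
  also have "\<dots> \<longleftrightarrow> (\<forall>t\<in>{-r..0}. U t = f t) \<and>
      (\<forall>t\<ge>0. U t = S t (f 0) + integral {0..t} (\<lambda>s. S (t - s) (k s *\<^sub>R B (U (s - \<tau> s)))))"
    by (simp add: duhamel_map_nonneg[OF S])
  finally show ?thesis
    using True int by (simp add: weak_solution_def)
qed (simp add: weak_solution_def)

lemma duhamel_fixed_point_unique:
  assumes \<tau>: "continuous_on {0..} \<tau>" "\<And>t. t \<ge> 0 \<Longrightarrow> 0 < \<tau> t \<and> \<tau> t \<le> r"
    and U: "\<And>t. t \<ge> -r \<Longrightarrow> U t = duhamel_map S B k \<tau> f U t"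
    and V: "\<And>t. t \<ge> -r \<Longrightarrow> V t = duhamel_map S B k \<tau> f V t"
    and "t \<ge> -r"
  shows "U t = V t"
proof -
  have init: "U s = V s" if "s \<in> {-r..0}" for s
    using U[of s] V[of s] that by simp
  have "\<exists>N::nat. \<forall>n\<ge>N. \<forall>s\<in>{-r..t}. U s = V s"
  proof (rule method_of_steps[OF \<tau> init])
    show "U s = duhamel_map S B k \<tau> f U s" "V s = duhamel_map S B k \<tau> f V s"
      if "s \<in> {-r..t}" for s
      using that U[of s] V[of s] by simp_all
  qed
  then show ?thesis using \<open>t \<ge> -r\<close> by auto
qed

text \<open>On each \<open>{-r..T}\<close> the iterates are eventually constant, so their pointwise
  limit coincides there with a single continuous iterate. Continuity of the limit follows at once,
  and causality gives the fixed-point equation.\<close>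

lemma duhamel_fixed_point_exists:
  assumes S: "C0_semigroup S" and M: "\<And>t. t \<ge> 0 \<Longrightarrow> norm (S t) \<le> M"
    and k: "\<And>T. k absolutely_integrable_on {0..T}"
    and \<tau>: "continuous_on {0..} \<tau>" "\<And>t. t \<ge> 0 \<Longrightarrow> 0 < \<tau> t \<and> \<tau> t \<le> r"
    and f: "continuous_on {-r..0} f" and "r \<ge> 0"
  obtains U where "continuous_on {-r..} U" "\<And>t. t \<ge> -r \<Longrightarrow> U t = duhamel_map S B k \<tau> f U t"
proof -
  let ?\<Phi> = "duhamel_map S B k \<tau> f"
  \<comment> \<open>The starting function extends \<open>f\<close> past 0 by the constant
    \<open>f 0\<close>; any continuous extension would do.\<close>
  define W where "W n = (?\<Phi> ^^ n) (\<lambda>t. f (min t 0))" for n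
  have W_Suc: "W (Suc n) = ?\<Phi> (W n)" for n by (simp add: W_def)
  have W_cont: "continuous_on {-r..} (W n)" for n
  proof (induction n)
    case 0
    show ?case unfolding W_def
      by (auto intro!: continuous_intros continuous_on_compose2[OF f] simp: \<open>r \<ge> 0\<close>)
  next
    case (Suc n)
    show ?case unfolding W_Suc
      by (rule duhamel_map_continuous[OF S M k \<tau>(1) _ f Suc \<open>r \<ge> 0\<close>]) (use \<tau>(2) in auto)
  qed
  have "\<exists>N. \<forall>n\<ge>N. \<forall>t\<in>{-r..T}. W (Suc n) t = W n t" for T
  \<comment> \<open>The two orbits compared are \<open>W\<close> and its shift by one; on
    \<open>{-r..0}\<close> their first members both equal \<open>f\<close>.\<close>
  proof (rule method_of_steps[OF \<tau>])
    show "W (Suc 0) t = W 0 t" if "t \<in> {-r..0}" for t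
      using that by (simp add: W_def min_def)
  qed (simp_all only: W_Suc)
  then obtain N where N: "\<And>T n t. n \<ge> N T \<Longrightarrow> t \<in> {-r..T} \<Longrightarrow> W (Suc n) t = W n t"
    by metis
  have stable: "W n t = W (N T) t" if "n \<ge> N T" "t \<in> {-r..T}" for n t T
    using that(1) by (induction n rule: dec_induct) (use N that(2) in auto)
  define U where "U t = W (N t) t" for t
  \<comment> \<open>\<open>N\<close> is not known to be monotone, so the indices \<open>n\<close>
    and \<open>N t\<close> are compared through their maximum.\<close>
  have U_eq: "U t = W n t" if "n \<ge> N T" "t \<in> {-r..T}" for n t T
    using stable[of t "max n (N t)" t] stable[of T "max n (N t)" t] stable[of T n t] that
    by (simp add: U_def)
  show thesis
  proof
    show "continuous_on {-r..} U"
    proof (rule continuous_on_atLeastI)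
      fix T
      have "continuous_on {-r..T} (W (N T))"
        by (rule continuous_on_subset[OF W_cont]) auto
      then show "continuous_on {-r..T} U"
        by (rule continuous_on_eq) (rule U_eq[OF order_refl, symmetric])
    qed
    fix t assume "t \<ge> -r"
    \<comment> \<open>\<open>U t\<close> is read off one iterate later, at \<open>Suc (N t)\<close>,
      which exposes an application of the map.\<close>
    then have "U t = ?\<Phi> (W (N t)) t"
      using U_eq[of t "Suc (N t)" t] by (simp add: W_Suc)
    also have "\<dots> = ?\<Phi> U t"
    \<comment> \<open>\<open>W (N t)\<close> agrees with \<open>U\<close> on all of
      \<open>{-r..t}\<close>, so no gain from the delay is required.\<close>
    proof (rule duhamel_map_causal[where \<delta> = 0 and a = t and r = r])
      show "0 \<le> \<tau> s \<and> \<tau> s \<le> r" if "s \<in> {0..t}" for s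
        using \<tau>(2)[of s] that by simp
      show "W (N t) s = U s" if "s \<in> {-r..t}" for s
        by (rule U_eq[OF order_refl that, symmetric])
    qed simp
    finally show "U t = ?\<Phi> U t" .
  qed
qed

theorem theorem2p1:
  fixes S :: "real \<Rightarrow> 'a::{real_inner,banach} \<Rightarrow>\<^sub>L 'a"
    and D :: "'a set" and A :: "'a \<Rightarrow> 'a"
    and B :: "'a \<Rightarrow>\<^sub>L 'a"
    and k \<tau> :: "real \<Rightarrow> real"
    and f :: "real \<Rightarrow> 'a"
    and M \<omega> \<tau>max K :: real
  assumes "C0_semigroup S"
    and "generator_of S D A"
    and "M > 0" and "\<omega> > 0"
    and "\<forall>t\<ge>0. norm (S t) \<le> M * exp (- \<omega> * t)"
    and "\<tau>max > 0"
    and "continuous_on {0..} \<tau>"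
    and "\<tau> ` {0..} \<subseteq> {0<..}"
    and "\<forall>t\<ge>0. 0 \<le> \<tau> t \<and> \<tau> t \<le> \<tau>max"
    and "L1_loc_on {-\<tau>max..} k"
    and "K > 0"
    and "\<forall>t\<ge>0. (LINT s:{t - \<tau>max..t}|lebesgue. \<bar>k s\<bar>) \<le> K"
    and "continuous_on {-\<tau>max..0} f"
  shows "\<exists>U. weak_solution S B k \<tau> \<tau>max f U \<and>
           (\<forall>V. weak_solution S B k \<tau> \<tau>max f V \<longrightarrow> (\<forall>t\<ge>-\<tau>max. V t = U t))"
proof -
  note S = \<open>C0_semigroup S\<close> and f = \<open>continuous_on {-\<tau>max..0} f\<close>
    and \<tau>_cont = \<open>continuous_on {0..} \<tau>\<close>
  have M: "norm (S t) \<le> M" if "t \<ge> 0" for t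
  proof -
    have "M * exp (- \<omega> * t) \<le> M * 1"
      using \<open>M > 0\<close> \<open>\<omega> > 0\<close> that by (intro mult_left_mono) auto
    then show ?thesis using assms(5) that by force
  qed
  have k: "k absolutely_integrable_on {0..T}" for T
    using assms(10) \<open>\<tau>max > 0\<close> by (auto simp: L1_loc_on_def)
  have \<tau>: "0 < \<tau> t \<and> \<tau> t \<le> \<tau>max" if "t \<ge> 0" for t
    using assms(8,9) that by auto
  then have \<tau>_le: "\<tau> t \<le> \<tau>max" if "t \<ge> 0" for t using that by blast
  have "\<tau>max \<ge> 0" using \<open>\<tau>max > 0\<close> by simp
  have iff: "weak_solution S B k \<tau> \<tau>max f V \<longleftrightarrow>
      continuous_on {-\<tau>max..} V \<and> (\<forall>t\<ge>-\<tau>max. V t = duhamel_map S B k \<tau> f V t)" for V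
    using S M k \<tau>_cont \<tau>_le \<open>\<tau>max \<ge> 0\<close> by (rule weak_solution_iff_duhamel_map)
  obtain U where U: "continuous_on {-\<tau>max..} U"
      "\<And>t. t \<ge> -\<tau>max \<Longrightarrow> U t = duhamel_map S B k \<tau> f U t"
    using duhamel_fixed_point_exists[OF S M k \<tau>_cont \<tau> f \<open>\<tau>max \<ge> 0\<close>] by blast
  have "V t = U t" if "weak_solution S B k \<tau> \<tau>max f V" "t \<ge> -\<tau>max" for V t
  proof (rule duhamel_fixed_point_unique[OF \<tau>_cont \<tau>])
    show "V s = duhamel_map S B k \<tau> f V s" if "s \<ge> -\<tau>max" for s
      using \<open>weak_solution S B k \<tau> \<tau>max f V\<close> that iff by blast
    show "U s = duhamel_map S B k \<tau> f U s" if "s \<ge> -\<tau>max" for s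
      using that by (rule U(2))
  qed (use that(2) in simp_all)
  then show ?thesis using U unfolding iff by blast
qed

end
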